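(* Let $(P,Q)$ and $(R,S)$ be two commuting Rota-Baxter systems on an $A_\infty$-algebra $(\mathcal{A},\mu_k)$. Then $(R,S)$ is a Rota-Baxter system on the $Dend_\infty$-algebra $(\mathcal{A},\mu_{k,[r]})$ induced from $(P,Q)$, where $\mu_{k,[r]}(a_1,\dots,a_k)=\mu_k(P(a_1),\dots,P(a_{r-1}),a_r,Q(a_{r+1}),\dots,Q(a_k))$. Consequently, there is a $Quad_\infty$-algebra $(\mathcal{A},\mu_{k,([r],[s])})$, where $$\mu_{k,([r],[s])}(a_1,\dots,a_k)=\mu_{k,[r]}(R(a_1),\dots,R(a_{s-1}),a_s,S(a_{s+1}),\dots,S(a_k)),\quad k\ge1,\ 1\le r,s\le k.$$
   Context: All vector spaces are over a field $\mathbb{K}$ of characteristic zero; $|a|$ denotes the degree of $a$. $A_\infty$-algebra: a graded vector space $\mathcal{A}=\oplus\mathcal{A}_i$ with multilinear maps $\mu_k:\mathcal{A}^{\otimes k}\to\mathcal{A}$, $\deg\mu_k=k-2$, $k\ge1$, such that for all $n\ge1$ and homogeneous $a_1,\dots,a_n$, $$\sum_{i+j=n+1}\sum_{\lambda=1}^j(-1)^{\lambda(i+1)+i(|a_1|+\cdots+|a_{\lambda-1}|)}\mu_j\big(a_1,\dots,a_{\lambda-1},\mu_i(a_\lambda,\dots,a_{\lambda+i-1}),a_{\lambda+i},\dots,a_n\big)=0.$$ A Rota-Baxter system on it is a pair of degree $0$ linear maps $R,S:\mathcal{A}\to\mathcal{A}$ such that for all $k\ge1$ both $T=R$ and $T=S$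 satisfy $\mu_k(T(a_1),\dots,T(a_k))=T\big(\sum_{i=1}^k\mu_k(R(a_1),\dots,R(a_{i-1}),a_i,S(a_{i+1}),\dots,S(a_k))\big)$. Two Rota-Baxter systems $(P,Q)$, $(R,S)$ commute if $PR=RP$, $PS=SP$, $QR=RQ$, $QS=SQ$. Index maps: let $C_n=\{[1],\dots,[n]\}$. For $m,n\ge1$, $1\le i\le m$, with $n$ in the $i$-th place of $(1,\dots,n,\dots,1)$ (length $m$), $R_0(m;1,\dots,n,\dots,1):C_{m+n-1}\to C_m$ and $R_i(m;1,\dots,n,\dots,1):C_{m+n-1}\to\mathbb{K}[C_n]$ are: if $1\le r\le i-1$, $R_0[r]=[r]$, $R_i[r]=[1]+\cdots+[n]$; if $i\le r\le i+n-1$, $R_0[r]=[i]$, $R_i[r]=[r-i+1]$; if $i+n\le r\le m+n-1$, $R_0[r]=[r-n+1]$, $R_i[r]=[1]+\cdots+[n]$. Let $Q_n=C_n\times C_n$ and $\overline{R}_j(m;1,\dots,n,\dots,1)([r],[s])=\big(R_j(m;1,\dots,n,\dots,1)[r],R_j(m;1,\dots,n,\dots,1)[s]\big)$ for $j=0,i$. $Dend_\infty$-algebra: a graded vector space with multilinear maps $\mu_{k,[r]}$, $[r]\in C_k$, of degree $k-2$, $k\ge1$ (extended linearly in $[r]$), such that for all $n\ge1$, $[r]\in C_n$, \begin{align*} \sum_{i+j=n+1}\sum_{\lambda=1}^j(-1)^{\lambda(i+1)+i(|a_1|+\cdots+|a_{\lambda-1}|)}\mu_{j,R_0(j;1,\dots,i,\dots,1)[r]}\big(a_1,\dots,a_{\lambda-1},\mu_{i,R_\lambda(j;1,\dots,i,\dots,1)[r]}(a_\lambda,\dots,a_{\lambda+i-1}),a_{\lambda+i},\dots,a_n\big)=0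 \end{align*} ($i$ in the $\lambda$-th place). A Rota-Baxter system on a $Dend_\infty$-algebra $(\mathcal{A},\mu_{k,[r]})$ is a pair of degree $0$ linear maps $R,S:\mathcal{A}\to\mathcal{A}$ such that for all $k\ge1$, $1\le r\le k$, both $T=R$ and $T=S$ satisfy $\mu_{k,[r]}(T(a_1),\dots,T(a_k))=T\big(\sum_{i=1}^k\mu_{k,[r]}(R(a_1),\dots,R(a_{i-1}),a_i,S(a_{i+1}),\dots,S(a_k))\big)$. $Quad_\infty$-algebra: a graded vector space with multilinear maps $\mu_{k,([r],[s])}$, $([r],[s])\in Q_k$, of degree $k-2$, $k\ge1$ (extended linearly in each of the two indices), satisfying, for all $n\ge1$ and $([r],[s])\in Q_n$, the identity displayed for $Dend_\infty$-algebras with $[r]$, $R_0$, $R_\lambda$ replaced by $([r],[s])$, $\overline{R}_0$, $\overline{R}_\lambda$. If $(P,Q)$ is a Rota-Baxter system on an $A_\infty$-algebra, the maps $\mu_{k,[r]}$ in the claim do form a $Dend_\infty$-algebra. *)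

theory Defs
  imports Complex_Main "HOL-Library.Poly_Mapping"
begin

text \<open>Graded vector spaces are graded by the integers; the grading is an internal direct sum
  decomposition. A map on the \<open>k\<close>-fold tensor power is a multilinear function on lists of length
  \<open>k\<close>; its values on lists of other lengths are irrelevant. Indices such as \<open>\<lambda>\<close>, \<open>r\<close>, \<open>s\<close>
  count from 1, whereas list positions count from 0.\<close>

locale graded_vector_space = vector_space scale
  for scale :: "'k::field_char_0 \<Rightarrow> 'a::ab_group_add \<Rightarrow> 'a" +
  fixes A :: "int \<Rightarrow> 'a set"
  assumes subspace_component: "\<And>d. subspace (A d)"
    and direct_sum: "\<And>x. \<exists>!f. (\<forall>d. f d \<in> A d) \<and> finite {d. f d \<noteq> 0} \<and> x = (\<Sum>d | f d \<noteq> 0. f d)"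

definition homogeneous_list :: "(int \<Rightarrow> 'a set) \<Rightarrow> 'a list \<Rightarrow> int list \<Rightarrow> bool"
  where "homogeneous_list A as ds \<longleftrightarrow> list_all2 (\<lambda>a d. a \<in> A d) as ds"

definition multilinear ::
    "('k::field_char_0 \<Rightarrow> 'a::ab_group_add \<Rightarrow> 'a) \<Rightarrow> nat \<Rightarrow> ('a list \<Rightarrow> 'a) \<Rightarrow> bool"
  where "multilinear scale k f \<longleftrightarrow>
    (\<forall>as p. length as = k \<and> p < k \<longrightarrow> Vector_Spaces.linear scale scale (\<lambda>x. f (as[p := x])))"

definition has_degree :: "(int \<Rightarrow> 'a set) \<Rightarrow> nat \<Rightarrow> ('a list \<Rightarrow> 'a) \<Rightarrow> int \<Rightarrow> bool"
  where "has_degree A k f e \<longleftrightarrow>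
    (\<forall>as ds. length as = k \<and> homogeneous_list A as ds \<longrightarrow> f as \<in> A (sum_list ds + e))"

definition degree_zero_linear ::
    "('k::field_char_0 \<Rightarrow> 'a::ab_group_add \<Rightarrow> 'a) \<Rightarrow> (int \<Rightarrow> 'a set) \<Rightarrow> ('a \<Rightarrow> 'a) \<Rightarrow> bool"
  where "degree_zero_linear scale A T \<longleftrightarrow>
    Vector_Spaces.linear scale scale T \<and> (\<forall>d. \<forall>a \<in> A d. T a \<in> A d)"

text \<open>The list \<open>a\<^sub>1, \<dots>, a\<^sub>l\<^sub>-\<^sub>1, g(a\<^sub>l, \<dots>, a\<^sub>l\<^sub>+\<^sub>i\<^sub>-\<^sub>1), a\<^sub>l\<^sub>+\<^sub>i, \<dots>, a\<^sub>n\<close>.\<close>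

definition insert_at :: "nat \<Rightarrow> nat \<Rightarrow> ('a list \<Rightarrow> 'a) \<Rightarrow> 'a list \<Rightarrow> 'a list"
  where "insert_at l i g as =
    take (l - 1) as @ [g (take i (drop (l - 1) as))] @ drop (l - 1 + i) as"

definition koszul_sign :: "nat \<Rightarrow> nat \<Rightarrow> int list \<Rightarrow> 'k::field_char_0"
  where "koszul_sign l i ds = (-1) powi (int l * (int i + 1) + int i * sum_list (take (l - 1) ds))"

text \<open>The list \<open>R(a\<^sub>1), \<dots>, R(a\<^sub>r\<^sub>-\<^sub>1), a\<^sub>r, S(a\<^sub>r\<^sub>+\<^sub>1), \<dots>, S(a\<^sub>k)\<close>.\<close>

definition spread :: "('a \<Rightarrow> 'a) \<Rightarrow> ('a \<Rightarrow> 'a) \<Rightarrow> nat \<Rightarrow> 'a list \<Rightarrow> 'a list"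
  where "spread R S r as = map R (take (r - 1) as) @ [as ! (r - 1)] @ map S (drop r as)"

definition rota_baxter_identities ::
    "nat \<Rightarrow> ('a::ab_group_add list \<Rightarrow> 'a) \<Rightarrow> ('a \<Rightarrow> 'a) \<Rightarrow> ('a \<Rightarrow> 'a) \<Rightarrow> bool"
  where "rota_baxter_identities k f R S \<longleftrightarrow>
    (\<forall>as. length as = k \<longrightarrow>
      f (map R as) = R (\<Sum>i = 1..k. f (spread R S i as)) \<and>
      f (map S as) = S (\<Sum>i = 1..k. f (spread R S i as)))"

locale A_infinity_algebra = graded_vector_space scale A
  for scale :: "'k::field_char_0 \<Rightarrow> 'a::ab_group_add \<Rightarrow> 'a" and A :: "int \<Rightarrow> 'a set" +
  fixes mu :: "nat \<Rightarrow> 'a list \<Rightarrow> 'a"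
  assumes mu_multilinear: "\<And>k. 1 \<le> k \<Longrightarrow> multilinear scale k (mu k)"
    and mu_degree: "\<And>k. 1 \<le> k \<Longrightarrow> has_degree A k (mu k) (int k - 2)"
    and A_infinity_identity: "\<And>n as ds. 1 \<le> n \<Longrightarrow> length as = n \<Longrightarrow> homogeneous_list A as ds \<Longrightarrow>
      (\<Sum>(i, j) \<in> {(i, j). 1 \<le> i \<and> 1 \<le> j \<and> i + j = n + 1}. \<Sum>l = 1..j.
        scale (koszul_sign l i ds) (mu j (insert_at l i (mu i) as))) = 0"

locale rota_baxter_system_A_infinity = A_infinity_algebra scale A mu
  for scale :: "'k::field_char_0 \<Rightarrow> 'a::ab_group_add \<Rightarrow> 'a" and A :: "int \<Rightarrow> 'a set"
    and mu :: "nat \<Rightarrow> 'a list \<Rightarrow> 'a" +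
  fixes R S :: "'a \<Rightarrow> 'a"
  assumes R_degree_zero_linear: "degree_zero_linear scale A R"
    and S_degree_zero_linear: "degree_zero_linear scale A S"
    and rota_baxter: "\<And>k. 1 \<le> k \<Longrightarrow> rota_baxter_identities k (mu k) R S"

definition commuting_systems ::
    "('a \<Rightarrow> 'a) \<Rightarrow> ('a \<Rightarrow> 'a) \<Rightarrow> ('a \<Rightarrow> 'a) \<Rightarrow> ('a \<Rightarrow> 'a) \<Rightarrow> bool"
  where "commuting_systems P Q R S \<longleftrightarrow>
    P \<circ> R = R \<circ> P \<and> P \<circ> S = S \<circ> P \<and> Q \<circ> R = R \<circ> Q \<and> Q \<circ> S = S \<circ> Q"

text \<open>The basis element \<open>[r]\<close> of \<open>C\<^sub>n\<close> is encoded by the number \<open>r \<in> {1..n}\<close>, and \<open>K[C\<^sub>n]\<close>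
  consists of finitely supported functions. The maps \<open>R\<^sub>0(m; 1,\<dots>,n,\<dots>,1)\<close> and
  \<open>R\<^sub>i(m; 1,\<dots>,n,\<dots>,1)\<close>, with \<open>n\<close> in place \<open>i\<close>, depend on \<open>m\<close> only through their domain
  \<open>C\<^sub>m\<^sub>+\<^sub>n\<^sub>-\<^sub>1\<close>, so \<open>m\<close> is not an argument. They are only used for \<open>r\<close> in that domain.\<close>

definition index_outer :: "nat \<Rightarrow> nat \<Rightarrow> nat \<Rightarrow> nat"
  where "index_outer i n r =
    (if r \<le> i - 1 then r else if r \<le> i + n - 1 then i else r - n + 1)"

definition index_inner :: "nat \<Rightarrow> nat \<Rightarrow> nat \<Rightarrow> nat \<Rightarrow>\<^sub>0 'k::field_char_0"
  where "index_inner i n r =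
    (if i \<le> r \<and> r \<le> i + n - 1 then Poly_Mapping.single (r - i + 1) 1
     else (\<Sum>t = 1..n. Poly_Mapping.single t 1))"

definition index_outer_pair :: "nat \<Rightarrow> nat \<Rightarrow> nat \<times> nat \<Rightarrow> nat \<times> nat"
  where "index_outer_pair i n = (\<lambda>(r, s). (index_outer i n r, index_outer i n s))"

definition index_inner_pair ::
    "nat \<Rightarrow> nat \<Rightarrow> nat \<times> nat \<Rightarrow> (nat \<Rightarrow>\<^sub>0 'k::field_char_0) \<times> (nat \<Rightarrow>\<^sub>0 'k)"
  where "index_inner_pair i n = (\<lambda>(r, s). (index_inner i n r, index_inner i n s))"

definition linear_extension ::
    "('k::field_char_0 \<Rightarrow> 'a::ab_group_add \<Rightarrow> 'a) \<Rightarrow> (nat \<Rightarrow> nat \<Rightarrow> 'a list \<Rightarrow> 'a) \<Rightarrow>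
      nat \<Rightarrow> (nat \<Rightarrow>\<^sub>0 'k) \<Rightarrow> 'a list \<Rightarrow> 'a"
  where "linear_extension scale mu k x as =
    (\<Sum>r = 1..k. scale (Poly_Mapping.lookup x r) (mu k r as))"

definition bilinear_extension ::
    "('k::field_char_0 \<Rightarrow> 'a::ab_group_add \<Rightarrow> 'a) \<Rightarrow> (nat \<Rightarrow> nat \<times> nat \<Rightarrow> 'a list \<Rightarrow> 'a) \<Rightarrow>
      nat \<Rightarrow> (nat \<Rightarrow>\<^sub>0 'k) \<times> (nat \<Rightarrow>\<^sub>0 'k) \<Rightarrow> 'a list \<Rightarrow> 'a"
  where "bilinear_extension scale mu k = (\<lambda>(x, y) as.
    \<Sum>r = 1..k. \<Sum>s = 1..k.
      scale (Poly_Mapping.lookup x r * Poly_Mapping.lookup y s) (mu k (r, s) as))"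

locale Dend_infinity_algebra = graded_vector_space scale A
  for scale :: "'k::field_char_0 \<Rightarrow> 'a::ab_group_add \<Rightarrow> 'a" and A :: "int \<Rightarrow> 'a set" +
  fixes mu :: "nat \<Rightarrow> nat \<Rightarrow> 'a list \<Rightarrow> 'a"
  assumes mu_multilinear: "\<And>k r. 1 \<le> k \<Longrightarrow> r \<in> {1..k} \<Longrightarrow> multilinear scale k (mu k r)"
    and mu_degree: "\<And>k r. 1 \<le> k \<Longrightarrow> r \<in> {1..k} \<Longrightarrow> has_degree A k (mu k r) (int k - 2)"
    and Dend_infinity_identity: "\<And>n r as ds. 1 \<le> n \<Longrightarrow> r \<in> {1..n} \<Longrightarrow> length as = n \<Longrightarrow>
      homogeneous_list A as ds \<Longrightarrow>
      (\<Sum>(i, j) \<in> {(i, j). 1 \<le> i \<and> 1 \<le> j \<and> i + j = n + 1}. \<Sum>l = 1..j.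
        scale (koszul_sign l i ds)
          (mu j (index_outer l i r)
            (insert_at l i (linear_extension scale mu i (index_inner l i r)) as))) = 0"

locale rota_baxter_system_Dend_infinity = Dend_infinity_algebra scale A mu
  for scale :: "'k::field_char_0 \<Rightarrow> 'a::ab_group_add \<Rightarrow> 'a" and A :: "int \<Rightarrow> 'a set"
    and mu :: "nat \<Rightarrow> nat \<Rightarrow> 'a list \<Rightarrow> 'a" +
  fixes R S :: "'a \<Rightarrow> 'a"
  assumes R_degree_zero_linear: "degree_zero_linear scale A R"
    and S_degree_zero_linear: "degree_zero_linear scale A S"
    and rota_baxter: "\<And>k r. 1 \<le> k \<Longrightarrow> r \<in> {1..k} \<Longrightarrow> rota_baxter_identities k (mu k r) R S"

locale Quad_infinity_algebra = graded_vector_space scale A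
  for scale :: "'k::field_char_0 \<Rightarrow> 'a::ab_group_add \<Rightarrow> 'a" and A :: "int \<Rightarrow> 'a set" +
  fixes mu :: "nat \<Rightarrow> nat \<times> nat \<Rightarrow> 'a list \<Rightarrow> 'a"
  assumes mu_multilinear:
      "\<And>k q. 1 \<le> k \<Longrightarrow> q \<in> {1..k} \<times> {1..k} \<Longrightarrow> multilinear scale k (mu k q)"
    and mu_degree:
      "\<And>k q. 1 \<le> k \<Longrightarrow> q \<in> {1..k} \<times> {1..k} \<Longrightarrow> has_degree A k (mu k q) (int k - 2)"
    and Quad_infinity_identity: "\<And>n q as ds. 1 \<le> n \<Longrightarrow> q \<in> {1..n} \<times> {1..n} \<Longrightarrow>
      length as = n \<Longrightarrow> homogeneous_list A as ds \<Longrightarrow>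
      (\<Sum>(i, j) \<in> {(i, j). 1 \<le> i \<and> 1 \<le> j \<and> i + j = n + 1}. \<Sum>l = 1..j.
        scale (koszul_sign l i ds)
          (mu j (index_outer_pair l i q)
            (insert_at l i (bilinear_extension scale mu i (index_inner_pair l i q)) as))) = 0"

definition Dend_operations ::
    "(nat \<Rightarrow> 'a list \<Rightarrow> 'a) \<Rightarrow> ('a \<Rightarrow> 'a) \<Rightarrow> ('a \<Rightarrow> 'a) \<Rightarrow> nat \<Rightarrow> nat \<Rightarrow> 'a list \<Rightarrow> 'a"
  where "Dend_operations mu P Q k r as = mu k (spread P Q r as)"

definition Quad_operations ::
    "(nat \<Rightarrow> nat \<Rightarrow> 'a list \<Rightarrow> 'a) \<Rightarrow> ('a \<Rightarrow> 'a) \<Rightarrow> ('a \<Rightarrow> 'a) \<Rightarrow>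
      nat \<Rightarrow> nat \<times> nat \<Rightarrow> 'a list \<Rightarrow> 'a"
  where "Quad_operations mu R S k = (\<lambda>(r, s) as. mu k r (spread R S s as))"

end

theory Submission imports Defs begin

text \<open>Each structure identity for the derived operations is the structure identity of the original
  ones, evaluated at \<open>P(a\<^sub>1), \<dots>, a\<^sub>r, \<dots>, Q(a\<^sub>n)\<close>, and the two agree term by term. If position \<open>r\<close>
  lies inside the inner operation, the inner arguments are again of this shape. Otherwise they are
  all hit by \<open>P\<close> or all by \<open>Q\<close>, and the Rota-Baxter identity pulls that map out, leaving the sum over
  all inner positions. The argument only needs the inner operation to satisfy the Rota-Baxter
  identities, so it covers both the step from \<open>A\<^sub>\<infinity>\<close> to \<open>Dend\<^sub>\<infinity>\<close> and the step from \<open>Dend\<^sub>\<infinity>\<close> to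
  \<open>Quad\<^sub>\<infinity>\<close>.\<close>

section \<open>Spread lists, whose \<open>r\<close>-th entry, the pivot, is left bare\<close>

lemma length_spread [simp]: "1 \<le> r \<Longrightarrow> r \<le> length as \<Longrightarrow> length (spread P Q r as) = length as"
  by (simp add: spread_def)

lemma nth_spread:
  assumes "1 \<le> r" "r \<le> length as" "p < length as"
  shows "spread P Q r as ! p =
    (if p + 1 < r then P (as ! p) else if p + 1 = r then as ! p else Q (as ! p))"
proof -
  consider "p + 1 < r" | "p + 1 = r" | "r \<le> p" by linarith
  then show ?thesis
  proof cases
    case 3
    \<comment> \<open>Past the pivot, the truncated difference is written as a successor so that
      indexing steps over the singleton middle list.\<close>
    then have "p - (r - 1) = Suc (p - r)" using assms by linarith
    then show ?thesis using 3 assms by (auto simp: spread_def nth_append min_def)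
  qed (use assms in \<open>auto simp: spread_def nth_append min_def\<close>)
qed

text \<open>Each entry receives at most one of \<open>P\<close>, \<open>Q\<close> and at most one of
  \<open>R\<close>, \<open>S\<close>, so the pivots \<open>r\<close> and \<open>s\<close> do not
  interact.\<close>

lemma spread_commute:
  assumes "commuting_systems P Q R S" "1 \<le> r" "r \<le> length as" "1 \<le> s" "s \<le> length as"
  shows "spread R S s (spread P Q r as) = spread P Q r (spread R S s as)"
  using assms by (intro nth_equalityI) (auto simp: nth_spread commuting_systems_def fun_eq_iff)

lemma spread_map_commute:
  assumes "P \<circ> T = T \<circ> P" "Q \<circ> T = T \<circ> Q" "1 \<le> r" "r \<le> length as"
  shows "spread P Q r (map T as) = map T (spread P Q r as)"
  using assms by (intro nth_equalityI) (auto simp: nth_spread fun_eq_iff)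

text \<open>The identities of \<open>f\<close> are used at \<open>spread P Q r as\<close>;
  commutation carries this spread past \<open>R\<close>, \<open>S\<close> and every
  \<open>spread R S i\<close>. For \<open>f = mu k\<close> this is the Rota-Baxter condition on the
  induced Dend operations.\<close>

lemma rota_baxter_identities_spread:
  assumes "commuting_systems P Q R S" "rota_baxter_identities k f R S" "r \<in> {1..k}"
  shows "rota_baxter_identities k (\<lambda>as. f (spread P Q r as)) R S"
  unfolding rota_baxter_identities_def
proof (intro allI impI)
  fix as :: "'a list"
  assume len: "length as = k"
  have "(\<Sum>i = 1..k. f (spread P Q r (spread R S i as))) =
      (\<Sum>i = 1..k. f (spread R S i (spread P Q r as)))"
    using assms(1,3) len by (intro sum.cong) (simp_all add: spread_commute)
  moreover have "f (map R (spread P Q r as)) = R (\<Sum>i = 1..k. f (spread R S i (spread P Q r as))) \<and>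
      f (map S (spread P Q r as)) = S (\<Sum>i = 1..k. f (spread R S i (spread P Q r as)))"
    using assms(2,3) len unfolding rota_baxter_identities_def by simp
  moreover have "spread P Q r (map R as) = map R (spread P Q r as)"
      "spread P Q r (map S as) = map S (spread P Q r as)"
    using assms(1,3) len by (auto simp: commuting_systems_def intro!: spread_map_commute)
  ultimately show "f (spread P Q r (map R as)) = R (\<Sum>i = 1..k. f (spread P Q r (spread R S i as))) \<and>
      f (spread P Q r (map S as)) = S (\<Sum>i = 1..k. f (spread P Q r (spread R S i as)))"
    by simp
qed

section \<open>Degree and multilinearity of operations on spread lists\<close>

lemma homogeneous_list_spread:
  assumes "homogeneous_list A as ds" "1 \<le> r" "r \<le> length as"
    "degree_zero_linear scale A P" "degree_zero_linear scale A Q"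
  shows "homogeneous_list A (spread P Q r as) ds"
  using assms
  by (auto simp: homogeneous_list_def list_all2_conv_all_nth nth_spread degree_zero_linear_def)

lemma has_degree_spread:
  assumes "has_degree A k f e" "r \<in> {1..k}"
    "degree_zero_linear scale A P" "degree_zero_linear scale A Q"
  shows "has_degree A k (\<lambda>as. f (spread P Q r as)) e"
  using assms homogeneous_list_spread[OF _ _ _ assms(3,4)] by (auto simp: has_degree_def)

lemma spread_list_update:
  assumes "1 \<le> r" "r \<le> length as" "p < length as"
  shows "spread P Q r (as[p := x]) =
    (spread P Q r as)[p := (if p + 1 < r then P x else if p + 1 = r then x else Q x)]"
  using assms by (intro nth_equalityI) (auto simp: nth_spread nth_list_update)

lemma multilinear_spread:
  fixes f :: "'a::ab_group_add list \<Rightarrow> 'a"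
  assumes "multilinear scale k f" "r \<in> {1..k}"
    "Vector_Spaces.linear scale scale P" "Vector_Spaces.linear scale scale Q"
  shows "multilinear scale k (\<lambda>as. f (spread P Q r as))"
  unfolding multilinear_def
proof (intro allI impI)
  fix as :: "'a list" and p
  assume as: "length as = k \<and> p < k"
  \<comment> \<open>The position \<open>p\<close> alone decides which of \<open>P\<close>, the
    identity and \<open>Q\<close> acts on the varied entry, so the slot map is
    \<open>L \<circ> h\<close> with both factors linear.\<close>
  define h where "h = (\<lambda>x. if p + 1 < r then P x else if p + 1 = r then x else Q x)"
  define L where "L = (\<lambda>y. f ((spread P Q r as)[p := y]))"
  have L: "Vector_Spaces.linear scale scale L"
    using assms(1,2) as unfolding multilinear_def L_def by simp
  have eq: "(\<lambda>x. f (spread P Q r (as[p := x]))) = (\<lambda>x. L (h x))"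
    using assms(2) as by (simp add: spread_list_update L_def h_def)
  consider "h = P" | "h = id" | "h = Q"
    by (cases "p + 1 < r"; cases "p + 1 = r") (simp_all add: h_def id_def)
  then have "Vector_Spaces.linear scale scale (L \<circ> h)"
    using L assms(3,4) by cases (simp_all add: Vector_Spaces.linear_compose)
  then show "Vector_Spaces.linear scale scale (\<lambda>x. f (spread P Q r (as[p := x])))"
    by (simp add: eq comp_def)
qed

section \<open>Inner operations inserted into spread lists\<close>

lemma take_drop_spread:
  assumes "1 \<le> r" "r \<le> length as" "1 \<le> l" "l + i \<le> length as + 1"
  shows "take i (drop (l - 1) (spread P Q r as)) =
    (if r < l then map Q (take i (drop (l - 1) as))
     else if r < l + i then spread P Q (r - l + 1) (take i (drop (l - 1) as))
     else map P (take i (drop (l - 1) as)))"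
  using assms by (intro nth_equalityI) (auto simp: nth_spread)

lemma nth_insert_at:
  assumes "1 \<le> l" "1 \<le> i" "l + i \<le> length as + 1" "p < length as + 1 - i"
  shows "insert_at l i g as ! p =
    (if p < l - 1 then as ! p
     else if p = l - 1 then g (take i (drop (l - 1) as)) else as ! (p + i - 1))"
proof -
  consider "p < l - 1" | "p = l - 1" | "l \<le> p" by linarith
  then show ?thesis
  proof cases
    case 3
    then have "p - (l - 1) = Suc (p - l)" "l - 1 + i + (p - l) = p + i - 1"
      using assms by linarith+
    then show ?thesis using 3 assms by (auto simp: insert_at_def nth_append min_def)
  qed (use assms in \<open>auto simp: insert_at_def nth_append min_def\<close>)
qed

lemma length_insert_at [simp]:
  "1 \<le> l \<Longrightarrow> l + i \<le> length as + 1 \<Longrightarrow> length (insert_at l i g as) = length as + 1 - i"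
  by (simp add: insert_at_def)

text \<open>The new pivot \<open>index_outer l i r\<close> decides which map acts on the inserted
  entry \<open>l\<close>. For \<open>r < l\<close> the pivot stays to its left, which gives
  \<open>Q\<close>; for \<open>r \<ge> l + i\<close> it becomes \<open>r - i + 1 > l\<close>, which
  gives \<open>P\<close>; otherwise it is \<open>l\<close> itself and the entry stays bare. The
  value of \<open>g\<close> on the window has to be brought into this form.\<close>

lemma insert_at_spread:
  assumes r: "1 \<le> r" "r \<le> length as" and l: "1 \<le> l" "1 \<le> i" "l + i \<le> length as + 1"
    and rb: "rota_baxter_identities i g P Q"
  shows "insert_at l i g (spread P Q r as) =
    spread P Q (index_outer l i r)
      (insert_at l i (\<lambda>bs. if l \<le> r \<and> r \<le> l + i - 1 then g (spread P Q (r - l + 1) bs)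
         else \<Sum>t = 1..i. g (spread P Q t bs)) as)"
    (is "_ = spread P Q ?r' (insert_at l i ?h as)")
proof (rule nth_equalityI)
  have r': "1 \<le> ?r'" "?r' \<le> length as + 1 - i"
    using r l by (auto simp: index_outer_def)
  then show "length (insert_at l i g (spread P Q r as)) = length (spread P Q ?r' (insert_at l i ?h as))"
    using r l by simp
  fix p
  assume "p < length (insert_at l i g (spread P Q r as))"
  then have p: "p < length as + 1 - i" using r l by simp
  let ?bs = "take i (drop (l - 1) as)"
  have len: "length ?bs = i" using l by auto
  \<comment> \<open>With the pivot outside, the window is mapped entirely by \<open>Q\<close> or by
    \<open>P\<close>, and the matching Rota-Baxter identity gives \<open>Q\<close> or
    \<open>P\<close> of the full sum \<open>?h ?bs\<close>. With the pivot inside, the window is a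
    spread list with pivot \<open>r - l + 1\<close>, as in \<open>?h\<close>.\<close>
  have g: "g (take i (drop (l - 1) (spread P Q r as))) =
      (if r < l then Q (?h ?bs) else if r < l + i then ?h ?bs else P (?h ?bs))"
    unfolding take_drop_spread[OF r l(1,3)] using l rb len
    by (auto simp: rota_baxter_identities_def)
  show "insert_at l i g (spread P Q r as) ! p = spread P Q ?r' (insert_at l i ?h as) ! p"
  proof -
    consider "p < l - 1" | "p = l - 1" | "l - 1 < p" by linarith
    then show ?thesis
    proof cases
      case 1
      then show ?thesis
        using p l r r' by (auto simp: nth_insert_at nth_spread index_outer_def)
    next
      case 2
      have "insert_at l i g (spread P Q r as) ! p = g (take i (drop (l - 1) (spread P Q r as)))"
        using 2 p l r by (subst nth_insert_at) auto
      moreover have "insert_at l i ?h as ! p = ?h ?bs"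
        using 2 p l by (subst nth_insert_at) auto
      moreover have "spread P Q ?r' (insert_at l i ?h as) ! p =
         (if r < l then Q (insert_at l i ?h as ! p) else if r < l + i then insert_at l i ?h as ! p
          else P (insert_at l i ?h as ! p))"
        using 2 p l r r' by (subst nth_spread) (auto simp: index_outer_def)
      ultimately show ?thesis using g by presburger
    next
      case 3
      have "insert_at l i g (spread P Q r as) ! p = spread P Q r as ! (p + i - 1)"
        using 3 p l r by (subst nth_insert_at) auto
      moreover have "insert_at l i ?h as ! p = as ! (p + i - 1)"
        using 3 p l by (subst nth_insert_at) auto
      ultimately show ?thesis
        using 3 p l r r' by (auto simp: nth_spread index_outer_def)
    qed
  qed
qed

section \<open>Linear extensions in the indices\<close>

lemma lookup_index_inner:
  assumes "1 \<le> i" "t \<in> {1..i}"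
  shows "Poly_Mapping.lookup (index_inner l i r) t =
    (if l \<le> r \<and> r \<le> l + i - 1 then (if t = r - l + 1 then 1 else 0) else 1)"
  using assms
  by (auto simp: index_inner_def lookup_single lookup_sum when_def)

context graded_vector_space
begin

text \<open>This identifies the case distinction of \<open>insert_at_spread\<close>: a pivot in the
  window selects one basis element, and any other gives the sum of all of them, with every
  coefficient 1.\<close>

lemma linear_extension_index_inner:
  assumes "1 \<le> i"
  shows "linear_extension scale m i (index_inner l i r) bs =
    (if l \<le> r \<and> r \<le> l + i - 1 then m i (r - l + 1) bs else \<Sum>t = 1..i. m i t bs)"
proof (cases "l \<le> r \<and> r \<le> l + i - 1")
  case True
  have "linear_extension scale m i (index_inner l i r) bs =
      (\<Sum>t = 1..i. if t = r - l + 1 then m i t bs else 0)"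
    unfolding linear_extension_def using assms True
    by (intro sum.cong) (auto simp: lookup_index_inner)
  also have "\<dots> = m i (r - l + 1) bs" using True assms by (subst sum.delta) auto
  finally show ?thesis using True by simp
next
  case False
  then show ?thesis unfolding linear_extension_def using assms
    by (auto simp: lookup_index_inner intro!: sum.cong)
qed

text \<open>For linear \<open>R\<close> and \<open>S\<close> the identities are linear in the
  operation. In the step to Quad-infinity the inner operation is such a combination over the first
  index.\<close>

lemma rota_baxter_identities_linear_extension:
  assumes "\<And>r. r \<in> {1..k} \<Longrightarrow> rota_baxter_identities k (m k r) R S"
    and R: "Vector_Spaces.linear scale scale R" and S: "Vector_Spaces.linear scale scale S"
  shows "rota_baxter_identities k (linear_extension scale m k x) R S"
proof -
  have aux: "linear_extension scale m k x (map T as) =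
      T (\<Sum>i = 1..k. linear_extension scale m k x (spread R S i as))"
    if T: "Vector_Spaces.linear scale scale T"
      and rb: "\<And>r. r \<in> {1..k} \<Longrightarrow> m k r (map T as) = T (\<Sum>i = 1..k. m k r (spread R S i as))"
    for T as
  proof -
    interpret T: Vector_Spaces.linear scale scale T by (rule T)
    have "linear_extension scale m k x (map T as) =
        T (\<Sum>r = 1..k. \<Sum>i = 1..k. scale (Poly_Mapping.lookup x r) (m k r (spread R S i as)))"
      using rb by (simp add: linear_extension_def T.sum T.scale scale_sum_right)
    also have "(\<Sum>r = 1..k. \<Sum>i = 1..k. scale (Poly_Mapping.lookup x r) (m k r (spread R S i as))) =
        (\<Sum>i = 1..k. linear_extension scale m k x (spread R S i as))"
      unfolding linear_extension_def by (rule sum.swap)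
    finally show ?thesis .
  qed
  show ?thesis
    using assms aux[OF R] aux[OF S] by (auto simp: rota_baxter_identities_def)
qed

text \<open>Separates the two indices: the coefficients \<open>x\<close> first merge the operations
  into one, and \<open>y\<close> then weights the spreads of its arguments. The inner Quad operation
  thus has the shape of an inner Dend operation.\<close>

lemma bilinear_extension_eq_linear_extension:
  "bilinear_extension scale (Quad_operations m R S) k (x, y) =
    linear_extension scale (\<lambda>k s bs. linear_extension scale m k x (spread R S s bs)) k y"
proof
  fix bs
  show "bilinear_extension scale (Quad_operations m R S) k (x, y) bs =
    linear_extension scale (\<lambda>k s bs. linear_extension scale m k x (spread R S s bs)) k y bs"
    unfolding bilinear_extension_def linear_extension_def Quad_operations_def prod.case
    by (subst sum.swap) (simp add: scale_sum_right mult.commute)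
qed

lemma insert_at_spread_linear_extension:
  assumes "1 \<le> r" "r \<le> length as" "1 \<le> l" "1 \<le> i" "l + i \<le> length as + 1"
    and "rota_baxter_identities i (g i) P Q"
  shows "insert_at l i (g i) (spread P Q r as) =
    spread P Q (index_outer l i r)
      (insert_at l i
        (linear_extension scale (\<lambda>k t bs. g k (spread P Q t bs)) i (index_inner l i r)) as)"
  using insert_at_spread[OF assms] unfolding linear_extension_index_inner[OF assms(4)] .

end

section \<open>From A-infinity to Dend-infinity\<close>

context rota_baxter_system_A_infinity
begin

theorem Dend_infinity_algebra_Dend_operations:
  "Dend_infinity_algebra scale A (Dend_operations mu R S)"
proof
  have lin: "Vector_Spaces.linear scale scale R" "Vector_Spaces.linear scale scale S"
    using R_degree_zero_linear S_degree_zero_linear by (auto simp: degree_zero_linear_def)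
  fix k r :: nat
  assume k: "1 \<le> k" and r: "r \<in> {1..k}"
  show "multilinear scale k (Dend_operations mu R S k r)"
    using multilinear_spread[OF mu_multilinear[OF k] r lin] by (simp add: Dend_operations_def[abs_def])
  show "has_degree A k (Dend_operations mu R S k r) (int k - 2)"
    using has_degree_spread[OF mu_degree[OF k] r R_degree_zero_linear S_degree_zero_linear]
    by (simp add: Dend_operations_def[abs_def])
next
  fix n r :: nat and as ds
  assume n: "1 \<le> n" and r: "r \<in> {1..n}" and len: "length as = n" and hom: "homogeneous_list A as ds"
  have "mu j (insert_at l i (mu i) (spread R S r as)) =
      Dend_operations mu R S j (index_outer l i r)
        (insert_at l i (linear_extension scale (Dend_operations mu R S) i (index_inner l i r)) as)"
    if "1 \<le> i" "1 \<le> j" "i + j = n + 1" "l \<in> {1..j}" for i j l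
    using insert_at_spread_linear_extension[of r as l i mu R S] that r len rota_baxter
    by (simp add: Dend_operations_def[abs_def])
  \<comment> \<open>Since \<open>R\<close> and \<open>S\<close> have degree zero, the spread list
    has the same degrees \<open>ds\<close>, so the Koszul signs are unchanged.\<close>
  moreover have "(\<Sum>(i, j) \<in> {(i, j). 1 \<le> i \<and> 1 \<le> j \<and> i + j = n + 1}. \<Sum>l = 1..j.
      scale (koszul_sign l i ds) (mu j (insert_at l i (mu i) (spread R S r as)))) = 0"
    using homogeneous_list_spread[OF hom _ _ R_degree_zero_linear S_degree_zero_linear] n r len
    by (intro A_infinity_identity) auto
  ultimately show "(\<Sum>(i, j) \<in> {(i, j). 1 \<le> i \<and> 1 \<le> j \<and> i + j = n + 1}. \<Sum>l = 1..j.
      scale (koszul_sign l i ds) (Dend_operations mu R S j (index_outer l i r)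
        (insert_at l i (linear_extension scale (Dend_operations mu R S) i (index_inner l i r)) as))) = 0"
    by (auto elim!: trans[rotated] intro!: sum.cong)
qed

end

section \<open>From Dend-infinity to Quad-infinity\<close>

context rota_baxter_system_Dend_infinity
begin

theorem Quad_infinity_algebra_Quad_operations:
  "Quad_infinity_algebra scale A (Quad_operations mu R S)"
proof
  have lin: "Vector_Spaces.linear scale scale R" "Vector_Spaces.linear scale scale S"
    using R_degree_zero_linear S_degree_zero_linear by (auto simp: degree_zero_linear_def)
  {
    fix k :: nat and q
    assume k: "1 \<le> k" and q: "q \<in> {1..k} \<times> {1..k}"
    obtain r s where rs: "q = (r, s)" "r \<in> {1..k}" "s \<in> {1..k}" using q by blast
    show "multilinear scale k (Quad_operations mu R S k q)"
      using multilinear_spread[OF mu_multilinear[OF k rs(2)] rs(3) lin]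
      by (simp add: Quad_operations_def rs(1))
    show "has_degree A k (Quad_operations mu R S k q) (int k - 2)"
      using has_degree_spread[OF mu_degree[OF k rs(2)] rs(3) R_degree_zero_linear S_degree_zero_linear]
      by (simp add: Quad_operations_def rs(1))
  }
  fix n :: nat and q as ds
  assume n: "1 \<le> n" and q: "q \<in> {1..n} \<times> {1..n}" and len: "length as = n"
    and hom: "homogeneous_list A as ds"
  obtain r s where rs: "q = (r, s)" "r \<in> {1..n}" "s \<in> {1..n}" using q by blast
  have "mu j (index_outer l i r)
        (insert_at l i (linear_extension scale mu i (index_inner l i r)) (spread R S s as)) =
      Quad_operations mu R S j (index_outer_pair l i q)
        (insert_at l i (bilinear_extension scale (Quad_operations mu R S) i (index_inner_pair l i q)) as)"
    if "1 \<le> i" "1 \<le> j" "i + j = n + 1" "l \<in> {1..j}" for i j l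
  proof -
    have "rota_baxter_identities i (linear_extension scale mu i (index_inner l i r)) R S"
      using rota_baxter that(1) lin by (intro rota_baxter_identities_linear_extension) auto
    then show ?thesis
      \<comment> \<open>The family freezes the coefficients of the first index, whose outer part
        already agrees on both sides; only the second index \<open>s\<close> is moved.\<close>
      using insert_at_spread_linear_extension
          [of s as l i "\<lambda>k. linear_extension scale mu k (index_inner l i r)" R S] that rs len
      by (simp add: Quad_operations_def[of mu R S j] index_outer_pair_def index_inner_pair_def
          bilinear_extension_eq_linear_extension)
  qed
  moreover have "(\<Sum>(i, j) \<in> {(i, j). 1 \<le> i \<and> 1 \<le> j \<and> i + j = n + 1}. \<Sum>l = 1..j.
      scale (koszul_sign l i ds) (mu j (index_outer l i r)
        (insert_at l i (linear_extension scale mu i (index_inner l i r)) (spread R S s as)))) = 0"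
    using homogeneous_list_spread[OF hom _ _ R_degree_zero_linear S_degree_zero_linear] n rs len
    by (intro Dend_infinity_identity) auto
  ultimately show "(\<Sum>(i, j) \<in> {(i, j). 1 \<le> i \<and> 1 \<le> j \<and> i + j = n + 1}. \<Sum>l = 1..j.
      scale (koszul_sign l i ds) (Quad_operations mu R S j (index_outer_pair l i q)
        (insert_at l i (bilinear_extension scale (Quad_operations mu R S) i (index_inner_pair l i q)) as))) = 0"
    by (auto elim!: trans[rotated] intro!: sum.cong)
qed

end

section \<open>Two commuting systems on one A-infinity algebra\<close>

theorem proposition7p12:
  fixes scale :: "'k::field_char_0 \<Rightarrow> 'a::ab_group_add \<Rightarrow> 'a"
    and A :: "int \<Rightarrow> 'a set"
    and mu :: "nat \<Rightarrow> 'a list \<Rightarrow> 'a"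
    and P Q R S :: "'a \<Rightarrow> 'a"
  assumes "A_infinity_algebra scale A mu"
    and "rota_baxter_system_A_infinity scale A mu P Q"
    and "rota_baxter_system_A_infinity scale A mu R S"
    and "commuting_systems P Q R S"
  shows "rota_baxter_system_Dend_infinity scale A (Dend_operations mu P Q) R S \<and>
    Quad_infinity_algebra scale A (Quad_operations (Dend_operations mu P Q) R S)"
proof -
  interpret PQ: rota_baxter_system_A_infinity scale A mu P Q by (rule assms(2))
  interpret RS: rota_baxter_system_A_infinity scale A mu R S by (rule assms(3))
  \<comment> \<open>With the Dend-infinity structure from \<open>P\<close>, \<open>Q\<close> in
    place, only the conditions on \<open>R\<close> and \<open>S\<close> remain for the next
    interpretation.\<close>
  interpret D: Dend_infinity_algebra scale A "Dend_operations mu P Q"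
    by (rule PQ.Dend_infinity_algebra_Dend_operations)
  interpret DRS: rota_baxter_system_Dend_infinity scale A "Dend_operations mu P Q" R S
  proof
    fix k r :: nat
    assume "1 \<le> k" "r \<in> {1..k}"
    then show "rota_baxter_identities k (Dend_operations mu P Q k r) R S"
      using rota_baxter_identities_spread[OF assms(4) RS.rota_baxter]
      by (simp add: Dend_operations_def[abs_def])
  qed (rule RS.R_degree_zero_linear RS.S_degree_zero_linear)+
  show ?thesis
    using DRS.rota_baxter_system_Dend_infinity_axioms DRS.Quad_infinity_algebra_Quad_operations
    by blast
qed

end
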